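(* Let $A$ be an infinite subset of $\mathbb{N}$ such that $r(A,n)\neq 1$ for all sufficiently large integers $n$. Then $$|A(x)|> \frac 12\left(\frac{\log x}{\log\log x}\right)^2$$ for all sufficiently large $x$.
   Context: $\mathbb{N}$ is the set of all natural numbers. For a set $A\subseteq\mathbb{N}$ and $n\in\mathbb{N}$, $r(A,n)$ denotes the number of solutions of the equation $n=a+b$ with $a,b\in A$ and $a\le b$. For real $x$, $A(x)$ is the set of integers in $A$ that are less than or equal to $x$, and $|A(x)|$ is its cardinality. $\log$ is the natural logarithm. "Sufficiently large" may depend on $A$. *)

theory Defs
  imports Complex_Main
begin

definition rep_count :: "nat set \<Rightarrow> nat \<Rightarrow> nat" where
  "rep_count A n = card {(a, b). a \<in> A \<and> b \<in> A \<and> a \<le> b \<and> n = a + b}"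

definition upto_set :: "nat set \<Rightarrow> real \<Rightarrow> nat set" where
  "upto_set A x = {a \<in> A. real a \<le> x}"

end

theory Submission
  imports Defs "HOL-Real_Asymp.Real_Asymp"
begin

text \<open>Cut (T, x] into n scales (T_j, R T_j] with R = 10 (n + 1). A scale with at most n elements of A
  contains some b_j in A, of size about R T_j, with no element of A in (b_j - T_j, b_j). For i < j the sum
  b_j + b_i has a second representation c + d. If c > b_j, the gap below b_i forces c - b_j to lie
  between T_i and R T_i, so these c are distinct for distinct i. If c < b_j, the gap below b_j places
  both c and d in scale j, and the lacunarity of the b_i again yields one new element for each i.
  Hence scale j contains at least one element for each lower scale with at most n elements, so A has
  at least n (n - 1) / 2 elements up to T R^n. Since ln R is smaller than ln (ln x) by about
  ln (ln (ln x)), one can take n > ln x / ln (ln x) + 1.\<close>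

section \<open>Gaps in finite sets and lacunary sums\<close>

text \<open>If every element of \<open>Z\<close> in (p, q] had another one less than \<delta> below
  it, descending from \<open>q\<close> would collect more than \<open>card Z\<close> elements before
  passing \<open>p\<close>. The type is general so that both natural numbers and real absolute
  values are covered.\<close>

lemma exists_gap_below:
  fixes Z :: "'a::linordered_semidom set"
  assumes "finite Z" "q \<in> Z" "0 < \<delta>" "p + of_nat (card Z) * \<delta> \<le> q"
  obtains v where "v \<in> Z" "p < v" "v \<le> q" "\<And>w. w \<in> Z \<Longrightarrow> w < v \<Longrightarrow> w + \<delta> \<le> v"
proof -
  have "\<exists>v\<in>Z. p < v \<and> v \<le> q \<and> (\<forall>w\<in>Z. w < v \<longrightarrow> w + \<delta> \<le> v)"
  proof (rule ccontr)
    assume "\<not> ?thesis"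
    then have dense: "\<exists>w\<in>Z. w < v \<and> v < w + \<delta>" if "v \<in> Z" "p < v" "v \<le> q" for v
      using that by (meson not_le)
    have many: "n < card {w \<in> Z. w \<le> v}" if "v \<in> Z" "v \<le> q" "p + of_nat n * \<delta> \<le> v" for n v
      using that
    proof (induction n arbitrary: v)
      case 0
      then have "v \<in> {w \<in> Z. w \<le> v}" by simp
      then show ?case
        using \<open>finite Z\<close> by (metis (no_types, lifting) card_gt_0_iff emptyE finite_Collect_conjI
            finite_subset mem_Collect_eq subsetI)
    next
      case (Suc n)
      have step: "p + of_nat n * \<delta> + \<delta> \<le> v"
        using Suc.prems(3) by (simp add: algebra_simps)
      have "0 \<le> of_nat n * \<delta>" using \<open>0 < \<delta>\<close> by simp
      then have "p < p + of_nat n * \<delta> + \<delta>"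
        using \<open>0 < \<delta>\<close> by (simp add: add.assoc add_nonneg_pos)
      then have "p < v" using step by order
      then obtain w where w: "w \<in> Z" "w < v" "v < w + \<delta>"
        using dense Suc.prems by blast
      have "p + of_nat n * \<delta> + \<delta> < w + \<delta>" using step w(3) by order
      then have "p + of_nat n * \<delta> \<le> w" by simp
      then have "n < card {u \<in> Z. u \<le> w}"
        using Suc.IH[of w] Suc.prems w by simp
      moreover have "card {u \<in> Z. u \<le> w} < card {u \<in> Z. u \<le> v}"
      proof (rule psubset_card_mono)
        show "{u \<in> Z. u \<le> w} \<subset> {u \<in> Z. u \<le> v}"
          using w Suc.prems(1) less_le_not_le[of w v] by (auto intro: order_trans)
      qed (use \<open>finite Z\<close> in simp)
      ultimately show ?case by linarith
    qed
    have "card Z < card {w \<in> Z. w \<le> q}"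
      using many[OF \<open>q \<in> Z\<close> order_refl] assms(4) by simp
    moreover have "card {w \<in> Z. w \<le> q} \<le> card Z"
      using \<open>finite Z\<close> by (intro card_mono) auto
    ultimately show False by simp
  qed
  then show thesis using that by blast
qed

text \<open>With y = 2 v - a the sums say that y + y' = 2 b, so the interval between |y| and |y'|, or
  the one between 0 and the larger of the two, has length comparable to b. One of the gaps into which
  the numbers |y| cut it is then at least b / (card V + 1), and lacunarity makes these gaps distinct
  for distinct b.\<close>
lemma card_le_if_lacunary_sums:
  fixes V B :: "nat set" and a :: nat
  assumes "finite V"
    and pos: "\<And>b. b \<in> B \<Longrightarrow> 0 < b"
    and lacunary: "\<And>b b'. b \<in> B \<Longrightarrow> b' \<in> B \<Longrightarrow> b < b' \<Longrightarrow> 2 * (card V + 1) * b < b'"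
    and sums: "\<And>b. b \<in> B \<Longrightarrow> \<exists>c\<in>V. \<exists>d\<in>V. c + d = a + b"
  shows "card B \<le> card V"
proof -
  define z where "z v = \<bar>2 * real v - real a\<bar>" for v
  define Z where "Z = insert 0 (z ` V)"
  define N where "N = card V + 1"
  have "finite Z" unfolding Z_def using \<open>finite V\<close> by simp
  have "card Z \<le> N"
    unfolding Z_def N_def using \<open>finite V\<close> card_image_le[of V z] card_insert_le_m1[of "card V + 1"]
    by (simp add: card_insert_if)
  have "\<exists>v\<in>V. (\<forall>w\<in>Z. w < z v \<longrightarrow> w + real b / real N \<le> z v) \<and>
      (\<exists>p\<in>Z. p < z v \<and> z v \<le> p + 2 * real b)" if "b \<in> B" for b
  proof -
    obtain c d where cd: "c \<in> V" "d \<in> V" "c + d = a + b" using sums \<open>b \<in> B\<close> by blast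
    have b: "0 < b" using pos \<open>b \<in> B\<close> .
    have sum: "(2 * real c - real a) + (2 * real d - real a) = 2 * real b"
      using cd(3) by linarith
    \<comment> \<open>If neither 2 c - a nor 2 d - a is negative, the larger lies between b and 2 b;
      the left end is then 0, which is why \<open>Z\<close> contains it. Otherwise exactly one is
      negative, and the absolute values differ by exactly 2 b.\<close>
    have "\<exists>p\<in>Z. \<exists>q\<in>Z. p + real b \<le> q \<and> q \<le> p + 2 * real b"
    proof (cases "2 * real c \<ge> real a \<and> 2 * real d \<ge> real a")
      case True
      have "0 \<in> Z" "max (z c) (z d) \<in> Z" using cd unfolding Z_def by (auto simp: max_def)
      moreover have "0 + real b \<le> max (z c) (z d)" "max (z c) (z d) \<le> 0 + 2 * real b"
        using True sum unfolding z_def by linarith+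
      ultimately show ?thesis by blast
    next
      case False
      then have "z c = z d + 2 * real b \<or> z d = z c + 2 * real b"
        using sum b unfolding z_def by linarith
      moreover have "z c \<in> Z" "z d \<in> Z" using cd unfolding Z_def by auto
      ultimately show ?thesis using b by (metis add_le_cancel_left le_add_same_cancel1 mult_2
            of_nat_0_le_iff order_refl)
    qed
    then obtain p q where pq: "p \<in> Z" "q \<in> Z" "p + real b \<le> q" "q \<le> p + 2 * real b" by blast
    have "real (card Z) * (real b / real N) \<le> real N * (real b / real N)"
      using \<open>card Z \<le> N\<close> by (intro mult_right_mono) auto
    also have "\<dots> = real b" unfolding N_def by simp
    finally have "p + real (card Z) * (real b / real N) \<le> q" using pq by linarith
    then obtain v where v: "v \<in> Z" "p < v" "v \<le> q"
        "\<And>w. w \<in> Z \<Longrightarrow> w < v \<Longrightarrow> w + real b / real N \<le> v"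
      using exists_gap_below[OF \<open>finite Z\<close> \<open>q \<in> Z\<close>, of "real b / real N" p] b
      unfolding N_def by auto
    \<comment> \<open>Since 0 \<le> p < v, the point \<open>v\<close> is not the inserted 0 and so
      comes from \<open>V\<close>.\<close>
    have "0 \<le> p" using \<open>p \<in> Z\<close> unfolding Z_def z_def by auto
    then obtain u where "u \<in> V" "v = z u" using v(1,2) unfolding Z_def by auto
    then show ?thesis using v pq by force
  qed
  then obtain f where f: "\<And>b. b \<in> B \<Longrightarrow> f b \<in> V"
      "\<And>b w. b \<in> B \<Longrightarrow> w \<in> Z \<Longrightarrow> w < z (f b) \<Longrightarrow> w + real b / real N \<le> z (f b)"
      "\<And>b. b \<in> B \<Longrightarrow> \<exists>p\<in>Z. p < z (f b) \<and> z (f b) \<le> p + 2 * real b"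
    by metis
  \<comment> \<open>A common value would have a point of \<open>Z\<close> at most 2 b below it, but
    also a gap of length b' / N > 2 b.\<close>
  have neq: "f b \<noteq> f b'" if "b \<in> B" "b' \<in> B" "b < b'" for b b'
  proof
    assume eq: "f b = f b'"
    obtain p where p: "p \<in> Z" "p < z (f b)" "z (f b) \<le> p + 2 * real b" using f(3) \<open>b \<in> B\<close> by blast
    have "p + real b' / real N \<le> z (f b)" using f(2)[of b' p] p eq that by simp
    then have "real b' / real N \<le> 2 * real b" using p by linarith
    then have "real b' \<le> real (2 * N * b)" unfolding N_def by (simp add: field_simps)
    then show False using lacunary[OF that] unfolding N_def by linarith
  qed
  have "inj_on f B" by (rule inj_onI) (metis neq linorder_neqE_nat)
  then show ?thesis using f(1) \<open>finite V\<close> by (intro card_inj_on_le) auto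
qed

section \<open>New elements from second representations in one scale\<close>

text \<open>Split \<open>B\<close> by whether a + b has a representation with a summand above
  \<open>a\<close>. Such b inject into A above \<open>a\<close>; the others are counted by
  \<open>card_le_if_lacunary_sums\<close> with V = A \<inter> (T, a). The two ranges are disjoint,
  so the counts add.\<close>

lemma card_above_ge:
  fixes A B :: "nat set" and a T :: nat
  assumes a: "\<And>w. w \<in> A \<Longrightarrow> w < a \<Longrightarrow> w + T \<le> a"
    and B: "\<And>b. b \<in> B \<Longrightarrow> 0 < b \<and> b \<le> T"
    and gaps: "\<And>b b' w. b \<in> B \<Longrightarrow> b' \<in> B \<Longrightarrow> b < b' \<Longrightarrow> w \<in> A \<Longrightarrow> w < b' \<Longrightarrow> w + b < b'"
    and lacunary: "\<And>b b'. b \<in> B \<Longrightarrow> b' \<in> B \<Longrightarrow> b < b' \<Longrightarrow>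
      2 * (card (A \<inter> {T<..<a}) + 1) * b < b'"
    and sums: "\<And>b. b \<in> B \<Longrightarrow> \<exists>c\<in>A. \<exists>d\<in>A. d \<le> c \<and> c + d = a + b \<and> c \<noteq> a"
    and "T \<le> a"
  shows "card B \<le> card (A \<inter> {T<..a + T})"
proof -
  define B1 where "B1 = {b \<in> B. \<exists>c\<in>A. \<exists>d\<in>A. a < c \<and> c + d = a + b}"
  define B2 where "B2 = B - B1"
  have "finite B" using B by (meson atMost_iff finite_atMost finite_subset subsetI)
  obtain f where f: "\<And>b. b \<in> B1 \<Longrightarrow> f b \<in> A \<and> a < f b \<and> (\<exists>d\<in>A. f b + d = a + b)"
  proof -
    have "\<forall>b\<in>B1. \<exists>c. c \<in> A \<and> a < c \<and> (\<exists>d\<in>A. c + d = a + b)" unfolding B1_def by blast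
    then show thesis using that by metis
  qed
  \<comment> \<open>Equal larger summands give d' = d + b' - b, which puts d' in [b' - b, b'),
    inside the gap below b'.\<close>
  have neq: "f b \<noteq> f b'" if bb: "b \<in> B1" "b' \<in> B1" "b < b'" for b b'
  proof
    assume eq: "f b = f b'"
    obtain d d' where d: "d \<in> A" "f b + d = a + b" "d' \<in> A" "f b' + d' = a + b'"
      using f bb by metis
    have "d' < b'" using f[OF \<open>b' \<in> B1\<close>] d by linarith
    then have "d' + b < b'" using gaps[of b b' d'] bb d unfolding B1_def by auto
    then show False using d eq by linarith
  qed
  have "inj_on f B1" by (rule inj_onI) (metis neq linorder_neqE_nat)
  moreover have "f ` B1 \<subseteq> A \<inter> {a<..a + T}"
  proof safe
    fix b assume "b \<in> B1"
    moreover from this have "b \<le> T" using B unfolding B1_def by blast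
    ultimately show "f b \<in> A" "f b \<in> {a<..a + T}" using f[of b] by auto
  qed
  ultimately have card1: "card B1 \<le> card (A \<inter> {a<..a + T})"
    by (intro card_inj_on_le) auto
  have "\<exists>c\<in>A \<inter> {T<..<a}. \<exists>d\<in>A \<inter> {T<..<a}. c + d = a + b" if "b \<in> B2" for b
  proof -
    have b: "b \<in> B" "b \<notin> B1" "0 < b" using that B unfolding B2_def by auto
    obtain c d where cd: "c \<in> A" "d \<in> A" "d \<le> c" "c + d = a + b" "c \<noteq> a"
      using sums[OF \<open>b \<in> B\<close>] by blast
    then have "c < a" using b unfolding B1_def by (metis (mono_tags, lifting) linorder_neqE_nat
          mem_Collect_eq)
    \<comment> \<open>The gap below \<open>a\<close> gives c + T \<le> a, hence d = a + b - c \<ge>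
      T + b.\<close>
    with cd a[of c] b have "T < d" by linarith
    with cd \<open>c < a\<close> show ?thesis by (intro bexI[of _ c] bexI[of _ d]) auto
  qed
  then have card2: "card B2 \<le> card (A \<inter> {T<..<a})"
    using B lacunary unfolding B2_def by (intro card_le_if_lacunary_sums) auto
  have "card B = card B1 + card B2"
    unfolding B1_def B2_def using \<open>finite B\<close>
    by (metis (no_types, lifting) B1_def add.commute card_Diff_subset card_mono finite_subset
        le_add_diff_inverse mem_Collect_eq subsetI)
  also have "\<dots> \<le> card (A \<inter> {a<..a + T}) + card (A \<inter> {T<..<a})" using card1 card2 by simp
  also have "\<dots> = card (A \<inter> {a<..a + T} \<union> A \<inter> {T<..<a})"
    by (rule card_Un_disjoint[symmetric]) auto
  also have "\<dots> \<le> card (A \<inter> {T<..a + T})" using \<open>T \<le> a\<close> by (intro card_mono) auto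
  finally show ?thesis .
qed

section \<open>Elements preceded by a long gap\<close>

text \<open>\<open>T\<^sub>0\<close> serves both as the threshold beyond which sums have a second
  representation and as the left end of the first scale.\<close>

locale sums_not_unique =
  fixes A :: "nat set" and T\<^sub>0 :: nat
  assumes start: "T\<^sub>0 \<in> A" "0 < T\<^sub>0"
    and other_sum: "\<And>a b. a \<in> A \<Longrightarrow> b \<in> A \<Longrightarrow> b \<le> a \<Longrightarrow> T\<^sub>0 \<le> a \<Longrightarrow>
      \<exists>c\<in>A. \<exists>d\<in>A. d \<le> c \<and> c + d = a + b \<and> c \<noteq> a"
begin

text \<open>For the largest a \<le> y in A, a second representation of 2 a has a summand above a. By
  maximality this summand exceeds y, and it is at most 2 a.\<close>

lemma exists_mem_double:
  assumes "T\<^sub>0 \<le> y"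
  obtains q where "q \<in> A" "y < q" "q \<le> 2 * y"
proof -
  define a where "a = Max {w \<in> A. w \<le> y}"
  have fin: "finite {w \<in> A. w \<le> y}" by simp
  have "T\<^sub>0 \<in> {w \<in> A. w \<le> y}" using assms start by simp
  then have a: "a \<in> A" "a \<le> y" "T\<^sub>0 \<le> a"
    unfolding a_def using Max_in[OF fin] Max_ge[OF fin] by blast+
  obtain c d where cd: "c \<in> A" "d \<le> c" "c + d = a + a" "c \<noteq> a"
    using other_sum[OF a(1) a(1)] a by auto
  have "y < c"
  proof (rule ccontr)
    assume "\<not> y < c"
    then have "c \<le> a" unfolding a_def using cd by (intro Max_ge[OF fin]) simp
    then show False using cd by linarith
  qed
  then show thesis using that[of c] cd a by linarith
qed

text \<open>For the scale (T, 5 k T]. The lower bound k T makes chosen elements of successive scales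
  lacunary; the upper bound 4 k T leaves room for b + T inside the scale.\<close>

definition spaced :: "nat \<Rightarrow> nat \<Rightarrow> nat \<Rightarrow> bool" where
  "spaced k T b \<longleftrightarrow> b \<in> A \<and> k * T < b \<and> b \<le> 4 * k * T \<and> (\<forall>w\<in>A. w < b \<longrightarrow> w + T \<le> b)"

text \<open>Doubling from 2 k T gives an element q of A in (2 k T, 4 k T]. As the scale has at most
  k elements, \<open>exists_gap_below\<close> applies between k T and q.\<close>

lemma exists_spaced:
  assumes "T\<^sub>0 \<le> T" "2 \<le> k" "card (A \<inter> {T<..5 * k * T}) \<le> k"
  shows "\<exists>b. spaced k T b"
proof -
  let ?Z = "A \<inter> {T<..5 * k * T}"
  have "T > 0" using assms start by simp
  have kT: "2 * T \<le> k * T" using assms(2) by simp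
  then obtain q where q: "q \<in> A" "2 * (k * T) < q" "q \<le> 2 * (2 * (k * T))"
    using exists_mem_double[of "2 * (k * T)"] assms(1) by (metis le_add2 le_trans mult_2)
  have "card ?Z * T \<le> k * T" using assms(3) by (rule mult_right_mono) simp
  then have "k * T + of_nat (card ?Z) * T \<le> q" using q by (simp only: of_nat_id)
  moreover have "T < q" "q \<le> 5 * k * T" using q kT \<open>T > 0\<close> unfolding mult.assoc by linarith+
  then have "q \<in> ?Z" using q by simp
  ultimately obtain b where b: "b \<in> ?Z" "k * T < b" "b \<le> q"
      "\<And>w. w \<in> ?Z \<Longrightarrow> w < b \<Longrightarrow> w + T \<le> b"
    using exists_gap_below[of ?Z q T "k * T"] \<open>T > 0\<close> by auto
  \<comment> \<open>The gap was found only among elements above T; the smaller ones are far enough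
    away because b > k T \<ge> 2 T.\<close>
  have "w + T \<le> b" if "w \<in> A" "w < b" for w
  proof (cases "w \<le> T")
    case True
    then show ?thesis using b(2) kT by linarith
  next
    case False
    then show ?thesis using b(1,4) that by simp
  qed
  then have "spaced k T b" unfolding spaced_def using b q by simp
  then show ?thesis ..
qed

section \<open>Counting over all scales\<close>

text \<open>A good scale contributes at least the number of good scales below it, any other at least
  n. With g good scales among n the total is at least 0 + 1 + ... + (g - 1) + n (n - g), which is
  smallest when all are good.\<close>

lemma card_scales_ge:
  fixes n :: nat
  defines "R \<equiv> 10 * (n + 1)"
  shows "n * (n - 1) \<le> 2 * card (A \<inter> {..T\<^sub>0 * R ^ n})"
proof -
  \<comment> \<open>This is the lacunarity factor 2 (card V + 1) for card V = n, and 5 k =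
    R.\<close>
  define k where "k = 2 * (n + 1)"
  define T where "T j = T\<^sub>0 * R ^ j" for j
  define S where "S j = A \<inter> {T j<..T (Suc j)}" for j
  define good where "good j \<longleftrightarrow> (\<exists>b. spaced k (T j) b)" for j
  define b where "b j = (SOME b. spaced k (T j) b)" for j
  have "0 < R" "2 \<le> k" unfolding R_def k_def by simp_all
  have T_Suc: "T (Suc j) = 5 * k * T j" for j unfolding T_def R_def k_def by simp
  have T_mono: "T i \<le> T j" if "i \<le> j" for i j
    unfolding T_def using that \<open>0 < R\<close> by (simp add: power_increasing)
  have T_ge: "T\<^sub>0 \<le> T j" for j using T_mono[of 0 j] unfolding T_def by simp
  have spaced_b: "spaced k (T j) (b j)" if "good j" for j
    using that unfolding good_def b_def by (rule someI_ex)
  have b_le: "b i < T j" if "good i" "i < j" for i j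
  proof -
    have "b i \<le> 4 * k * T i" using spaced_b[OF that(1)] unfolding spaced_def by simp
    also have "\<dots> < 5 * k * T i" using \<open>2 \<le> k\<close> T_ge[of i] start by simp
    also have "\<dots> \<le> T j" using T_mono[of "Suc i" j] that(2) T_Suc by simp
    finally show ?thesis .
  qed
  have b_ge: "T j \<le> b j" "k * T j < b j" if "good j" for j
  proof -
    show "k * T j < b j" using spaced_b[OF that] unfolding spaced_def by simp
    moreover have "1 * T j \<le> k * T j" using \<open>2 \<le> k\<close> by (intro mult_right_mono) simp_all
    ultimately show "T j \<le> b j" by linarith
  qed
  have b_less: "b i < b j" if "good i" "good j" "i < j" for i j
    using b_le[of i j] b_ge[of j] that by simp
  have b_less_iff: "b i < b j \<longleftrightarrow> i < j" if "good i" "good j" for i j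
    using b_less that by (metis less_asym linorder_neqE_nat)

  have good_card: "card {i. i < j \<and> good i} \<le> card (S j)" if "good j" "card (S j) \<le> n" for j
  proof -
    let ?B = "b ` {i. i < j \<and> good i}"
    have a: "b j \<in> A" "b j \<le> 4 * k * T j" "\<And>w. w \<in> A \<Longrightarrow> w < b j \<Longrightarrow> w + T j \<le> b j"
      using spaced_b[OF \<open>good j\<close>] unfolding spaced_def by simp_all
    have top: "b j + T j \<le> T (Suc j)"
    proof -
      have "1 * T j \<le> k * T j" using \<open>2 \<le> k\<close> by (intro mult_right_mono) simp_all
      then show ?thesis using a(2) unfolding T_Suc mult.assoc by linarith
    qed
    have "A \<inter> {T j<..<b j} \<subseteq> S j" unfolding S_def using top by auto
    then have cardV: "card (A \<inter> {T j<..<b j}) \<le> n"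
      using that(2) card_mono[of "S j" "A \<inter> {T j<..<b j}"] unfolding S_def by simp
    have "inj_on b {i. i < j \<and> good i}"
      by (rule inj_onI) (metis (mono_tags, lifting) b_less_iff less_irrefl linorder_neqE_nat
          mem_Collect_eq)
    then have "card {i. i < j \<and> good i} = card ?B" by (simp add: card_image)
    also have "\<dots> \<le> card (A \<inter> {T j<..b j + T j})"
    proof (rule card_above_ge)
      show "w + T j \<le> b j" if "w \<in> A" "w < b j" for w using a(3) that .
      show "0 < c \<and> c \<le> T j" if "c \<in> ?B" for c
        using that b_le b_ge(2) by fastforce
      show "w + c < c'" if "c \<in> ?B" "c' \<in> ?B" "c < c'" "w \<in> A" "w < c'" for c c' w
      proof -
        obtain i i' where i: "c = b i" "c' = b i'" "good i" "good i'" "i < i'"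
          using \<open>c \<in> ?B\<close> \<open>c' \<in> ?B\<close> \<open>c < c'\<close> b_less_iff by auto
        have "w + T i' \<le> c'"
          using spaced_b[OF i(4)] that i unfolding spaced_def by simp
        then show ?thesis using b_le[OF i(3,5)] i by simp
      qed
      show "2 * (card (A \<inter> {T j<..<b j}) + 1) * c < c'" if "c \<in> ?B" "c' \<in> ?B" "c < c'" for c c'
      proof -
        obtain i i' where i: "c = b i" "c' = b i'" "good i" "good i'" "i < i'"
          using \<open>c \<in> ?B\<close> \<open>c' \<in> ?B\<close> \<open>c < c'\<close> b_less_iff by auto
        \<comment> \<open>The element \<open>T i'\<close> separates the two: b i < T i', while b i'
          > k * T i'.\<close>
        have "2 * (card (A \<inter> {T j<..<b j}) + 1) * c \<le> k * T i'"
          unfolding k_def using cardV b_le[OF i(3,5)] i by (intro mult_mono) simp_all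
        then show ?thesis using b_ge(2)[OF i(4)] i by simp
      qed
      show "\<exists>c'\<in>A. \<exists>d\<in>A. d \<le> c' \<and> c' + d = b j + c \<and> c' \<noteq> b j" if "c \<in> ?B" for c
      proof -
        obtain i where i: "c = b i" "good i" "i < j" using \<open>c \<in> ?B\<close> by blast
        then have "c \<in> A" using spaced_b unfolding spaced_def by blast
        moreover have "c \<le> b j" using b_less[OF i(2) \<open>good j\<close> i(3)] i by simp
        moreover have "T\<^sub>0 \<le> b j" using T_ge b_ge(1)[OF \<open>good j\<close>] order_trans by blast
        ultimately show ?thesis using other_sum a(1) by blast
      qed
      show "T j \<le> b j" using b_ge(1)[OF \<open>good j\<close>] .
    qed
    also have "\<dots> \<le> card (S j)"
      unfolding S_def using top by (intro card_mono) auto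
    finally show ?thesis .
  qed

  define g where "g m = card {i. i < m \<and> good i}" for m
  have g_le: "g m \<le> m" for m
    unfolding g_def using card_mono[of "{..<m}" "{i. i < m \<and> good i}"] by auto
  have g_Suc: "g (Suc m) = g m + (if good m then 1 else 0)" for m
  proof -
    have "{i. i < Suc m \<and> good i} = {i. i < m \<and> good i} \<union> (if good m then {m} else {})"
      by (auto simp: less_Suc_eq)
    then show ?thesis unfolding g_def by simp
  qed
  \<comment> \<open>A scale with at most n elements is good because n \<le> k. A scale with more
    than n elements, good or not, exceeds \<open>g m\<close> since g m \<le> m < n.\<close>
  have card_S: "(if good m then g m else n) \<le> card (S m)" if "m < n" for m
  proof (cases "card (S m) \<le> n")
    case True
    then have "good m"
      using exists_spaced[OF T_ge[of m] \<open>2 \<le> k\<close>] T_Suc unfolding good_def S_def k_def by simp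
    then show ?thesis using good_card True unfolding g_def by simp
  next
    case False
    then show ?thesis using g_le[of m] that by simp
  qed
  have count: "int (g m) * (int (g m) - 1) + 2 * int n * (int m - int (g m)) \<le>
      2 * int (card (A \<inter> {T 0<..T m}))" if "m \<le> n" for m
    using that
  proof (induction m)
    case 0
    then show ?case unfolding g_def by simp
  next
    case (Suc m)
    have "A \<inter> {T 0<..T (Suc m)} = A \<inter> {T 0<..T m} \<union> S m"
      unfolding S_def using T_mono[of 0 m] T_mono[of m "Suc m"] by auto
    also have "card \<dots> = card (A \<inter> {T 0<..T m}) + card (S m)"
      unfolding S_def by (rule card_Un_disjoint) auto
    finally show ?case using Suc card_S[of m] g_Suc[of m]
      by (auto simp: algebra_simps split: if_splits)
  qed
  \<comment> \<open>This product is the excess of the left side of \<open>count\<close> at m = n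
    over n (n - 1).\<close>
  have "0 \<le> (int n - int (g n)) * (int n - int (g n) + 1)" using g_le[of n] by simp
  then have "int n * (int n - 1) \<le> 2 * int (card (A \<inter> {T 0<..T n}))"
    using count[of n] by (simp add: algebra_simps)
  moreover have "card (A \<inter> {T 0<..T n}) \<le> card (A \<inter> {..T n})" by (intro card_mono) auto
  ultimately have "int n * (int n - 1) \<le> 2 * int (card (A \<inter> {..T n}))" by simp
  then have "int (n * (n - 1)) \<le> int (2 * card (A \<inter> {..T n}))"
    by (cases n) (simp_all add: algebra_simps)
  then show ?thesis unfolding T_def by (simp only: of_nat_le_iff)
qed

end

section \<open>The asymptotic bound\<close>

text \<open>The pair (b, a) is one solution, so there is another; as both pairs are ordered, their
  larger summands differ.\<close>

lemma other_representation:
  assumes "a \<in> A" "b \<in> A" "b \<le> a" "rep_count A (a + b) \<noteq> 1"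
  shows "\<exists>c\<in>A. \<exists>d\<in>A. d \<le> c \<and> c + d = a + b \<and> c \<noteq> a"
proof (rule ccontr)
  assume "\<not> ?thesis"
  then have "{(d, c). d \<in> A \<and> c \<in> A \<and> d \<le> c \<and> a + b = d + c} = {(b, a)}"
    using assms(1-3) by (auto simp: add.commute)
  then have "rep_count A (a + b) = 1" unfolding rep_count_def by simp
  then show False using assms(4) by simp
qed

theorem theorem1p1:
  fixes A :: "nat set"
  assumes "infinite A"
    and "\<forall>\<^sub>F n in sequentially. rep_count A n \<noteq> 1"
  shows "\<forall>\<^sub>F x::real in at_top.
           real (card (upto_set A x)) > 1 / 2 * (ln x / ln (ln x))\<^sup>2"
proof -
  obtain N where N: "\<And>n. N \<le> n \<Longrightarrow> rep_count A n \<noteq> 1"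
    using assms(2) unfolding eventually_sequentially by blast
  obtain T where T: "T \<in> A" "N < T"
    using assms(1) by (meson finite_nat_set_iff_bounded_le not_le)
  interpret sums_not_unique A T
  proof
    show "T \<in> A" "0 < T" using T by simp_all
    show "\<exists>c\<in>A. \<exists>d\<in>A. d \<le> c \<and> c + d = a + b \<and> c \<noteq> a"
      if "a \<in> A" "b \<in> A" "b \<le> a" "T \<le> a" for a b
      using that N[of "a + b"] T by (intro other_representation) auto
  qed
  define \<phi> :: "real \<Rightarrow> real" where "\<phi> x = ln x / ln (ln x)" for x
  \<comment> \<open>Since ln (\<phi> x) = ln (ln x) - ln (ln (ln x)), the product falls short of ln
    x by about \<phi> x * ln (ln (ln x)), which absorbs the constants.\<close>
  have "\<forall>\<^sub>F x in at_top. ln (real T) + (\<phi> x + 2) * ln (10 * (\<phi> x + 3)) \<le> ln x"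
    unfolding \<phi>_def by real_asymp
  moreover have "\<forall>\<^sub>F x in at_top. 0 < \<phi> x" unfolding \<phi>_def by real_asymp
  moreover have "\<forall>\<^sub>F x::real in at_top. 0 < x" by (rule eventually_gt_at_top)
  ultimately show ?thesis
  proof eventually_elim
    case (elim x)
    \<comment> \<open>The offset 2 makes n - 1 exceed \<phi> x, so that n (n - 1) > (\<phi> x)^2,
      while n \<le> \<phi> x + 2 keeps \<open>?M\<close> below x.\<close>
    define n where "n = nat \<lfloor>\<phi> x\<rfloor> + 2"
    have n: "\<phi> x + 1 < real n" "real n \<le> \<phi> x + 2"
      unfolding n_def using elim(2) by (simp_all, linarith+)
    let ?M = "T * (10 * (n + 1)) ^ n"
    have "ln (real ?M) = ln (real T) + real n * ln (10 * (real n + 1))"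
      using start by (simp add: ln_mult ln_realpow)
    also have "\<dots> \<le> ln (real T) + (\<phi> x + 2) * ln (10 * (\<phi> x + 3))"
      using n elim(2) by (intro add_left_mono mult_mono) (simp_all add: ln_ge_zero)
    also have "\<dots> \<le> ln x" using elim by simp
    finally have "real ?M \<le> x"
      using elim(3) start by (subst (asm) ln_le_cancel_iff) simp_all
    then have "A \<inter> {..?M} \<subseteq> upto_set A x"
      unfolding upto_set_def by (auto intro: order_trans[OF of_nat_mono])
    moreover have "finite (upto_set A x)"
      by (rule finite_subset[of _ "{..nat \<lfloor>x\<rfloor>}"]) (auto simp: upto_set_def le_nat_floor)
    ultimately have "card (A \<inter> {..?M}) \<le> card (upto_set A x)" by (rule card_mono[rotated])
    then have "n * (n - 1) \<le> 2 * card (upto_set A x)" using card_scales_ge[of n] by linarith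
    then have "real n * real (n - 1) \<le> 2 * real (card (upto_set A x))"
      by (metis of_nat_le_iff of_nat_mult of_nat_numeral)
    moreover have "\<phi> x * \<phi> x < real n * real (n - 1)"
      using n elim(2) unfolding n_def by (intro mult_strict_mono) simp_all
    ultimately show ?case unfolding \<phi>_def[symmetric] power2_eq_square by linarith
  qed
qed

end
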